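(* Let $\phi_0,\phi_1,\dots,\phi_N\in B_1$ be the fractal interpolation functions satisfying $\phi_i(x_j)=\delta_{ij}$ for all $i,j\in\{0,1,\dots,N\}$ (with $\delta_{ij}$ the Kronecker delta), and let $f:[a,b]\to\mathbb{R}$ be continuous. Then there exists a unique $(\alpha_0^*,\alpha_1^*,\dots,\alpha_N^* )\in\mathbb{R}^{N+1}$ such that $$\min_{(\alpha_0,\dots,\alpha_N)\in\mathbb{R}^{N+1}}\Big\|f-\sum_{k=0}^N\alpha_k\phi_k\Big\|_{L_2}=\Big\|f-\sum_{k=0}^N\alpha_k^*\phi_k\Big\|_{L_2}.$$
   Context: Let $[a,b]$ be a closed interval with $a<b$, let $N\ge 2$ be an integer, and let $a=x_0<x_1<\cdots<x_N=b$ be a partition. For $l=0,\dots,N-1$ let $u_l(x)=a_lx+b_l$ be the affine map with $u_l(x_0)=x_l$ and $u_l(x_N)=x_{l+1}$. Fix real numbers $s_0,\dots,s_{N-1}$ with $|s_l|<1$ for every $l$. Let $P_1$ be the space of real polynomials of degree at most $1$. For $\lambda=(\lambda_0,\dots,\lambda_{N-1})\in\prod_{l=0}^{N-1}P_1$, the fractal function $f_\lambda$ is the unique bounded function $f_\lambda:[a,b)\to\mathbb{R}$ with $f_\lambda(x)=s_l\,f_\lambda(u_l^{-1}(x))+\lambda_l(u_l^{-1}(x))$ for all $x\in[x_l,x_{l+1})$ and all $l=0,\dots,N-1$; it is extended to $[a,b]$ by setting $f_\lambda(b)=\lim_{x\to b^-}f_\lambda(x)$. The space $B_1$ is the set of all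 these functions $f_\lambda:[a,b]\to\mathbb{R}$ with $\lambda\in\prod_{l=0}^{N-1}P_1$. A fractal interpolation function in $B_1$ is an element of $B_1$ which is continuous on $[a,b]$ and takes prescribed values at the points $x_0,\dots,x_N$. The norm is $\|g\|_{L_2}=\big(\int_a^b g(x)^2\,dx\big)^{1/2}$. *)

theory Defs
  imports "HOL-Analysis.Analysis" "HOL-Computational_Algebra.Polynomial"
begin

definition interval_partition :: "nat \<Rightarrow> (nat \<Rightarrow> real) \<Rightarrow> real \<Rightarrow> real \<Rightarrow> bool" where
  "interval_partition N x a b \<longleftrightarrow> x 0 = a \<and> x N = b \<and> (\<forall>l<N. x l < x (Suc l))"

text \<open>The affine map of the real line sending the end points \<open>x 0\<close>, \<open>x N\<close> to \<open>x l\<close>, \<open>x (Suc l)\<close>.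
  For a partition its slope is positive, so it is a bijection of the line and \<open>inv\<close> is its true
  inverse.\<close>

definition piece_map :: "nat \<Rightarrow> (nat \<Rightarrow> real) \<Rightarrow> nat \<Rightarrow> real \<Rightarrow> real" where
  "piece_map N x l t = x l + (x (Suc l) - x l) / (x N - x 0) * (t - x 0)"

text \<open>A function on the closed interval from \<open>x 0\<close> to \<open>x N\<close> is represented by a function on the
  reals whose values outside the interval are irrelevant; on the interval itself the predicate
  below determines \<open>g\<close> uniquely (lemma \<open>is_fractal_function_unique\<close>).\<close>

definition is_fractal_function ::
  "nat \<Rightarrow> (nat \<Rightarrow> real) \<Rightarrow> (nat \<Rightarrow> real) \<Rightarrow> (nat \<Rightarrow> real poly) \<Rightarrow> (real \<Rightarrow> real) \<Rightarrow> bool" where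
  "is_fractal_function N x s lam g \<longleftrightarrow>
     bounded (g ` {x 0..<x N}) \<and>
     (\<forall>l<N. \<forall>t\<in>{x l..<x (Suc l)}.
        g t = s l * g (inv (piece_map N x l) t) + poly (lam l) (inv (piece_map N x l) t)) \<and>
     (g \<longlongrightarrow> g (x N)) (at_left (x N))"

definition B1 :: "nat \<Rightarrow> (nat \<Rightarrow> real) \<Rightarrow> (nat \<Rightarrow> real) \<Rightarrow> (real \<Rightarrow> real) set" where
  "B1 N x s = {g. \<exists>lam. (\<forall>l<N. degree (lam l) \<le> 1) \<and> is_fractal_function N x s lam g}"

definition fractal_interpolation_function ::
  "nat \<Rightarrow> (nat \<Rightarrow> real) \<Rightarrow> (nat \<Rightarrow> real) \<Rightarrow> (nat \<Rightarrow> real) \<Rightarrow> (real \<Rightarrow> real) \<Rightarrow> bool" where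
  "fractal_interpolation_function N x s y g \<longleftrightarrow>
     g \<in> B1 N x s \<and> continuous_on {x 0..x N} g \<and> (\<forall>j\<le>N. g (x j) = y j)"

definition L2_norm :: "real \<Rightarrow> real \<Rightarrow> (real \<Rightarrow> real) \<Rightarrow> real" where
  "L2_norm a b g = sqrt (integral {a..b} (\<lambda>t. (g t)\<^sup>2))"

lemma partition_piece:
  assumes "\<forall>l<n. x l < x (Suc l)" and "x 0 \<le> t" and "t < x n"
  shows "\<exists>l<n. x l \<le> t \<and> t < (x (Suc l) :: real)"
  using assms
proof (induction n)
  case (Suc n)
  show ?case
  proof (cases "t < x n")
    case True
    with Suc show ?thesis by (meson less_SucI)
  next
    case False
    with Suc show ?thesis by (meson lessI not_less)
  qed
qed simp

lemma piece_map_inv: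
  assumes "x 0 < x N" and "x l < x (Suc l)"
  shows "inv (piece_map N x l) t = x 0 + (x N - x 0) / (x (Suc l) - x l) * (t - x l)"
proof (rule inv_f_eq)
  show "inj (piece_map N x l)"
    using assms by (auto simp: inj_def piece_map_def)
  show "piece_map N x l (x 0 + (x N - x 0) / (x (Suc l) - x l) * (t - x l)) = t"
    using assms by (simp add: piece_map_def)
qed

lemma piece_map_inv_mem:
  assumes "x 0 < x N" and "x l \<le> t" and "t < x (Suc l)"
  shows "inv (piece_map N x l) t \<in> {x 0..<x N}"
proof -
  have l: "x l < x (Suc l)" using assms by simp
  have "(t - x l) / (x (Suc l) - x l) < 1" using assms l by (simp add: divide_simps)
  then have "(x N - x 0) * ((t - x l) / (x (Suc l) - x l)) < (x N - x 0) * 1"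
    using assms(1) by (intro mult_strict_left_mono) auto
  moreover have "0 \<le> (x N - x 0) * ((t - x l) / (x (Suc l) - x l))"
    using assms l by simp
  ultimately show ?thesis
    by (simp add: piece_map_inv[of x N l t, OF assms(1) l])
qed

lemma is_fractal_function_unique:
  assumes part: "interval_partition N x a b" and "a < b" and s: "\<forall>l<N. \<bar>s l\<bar> < 1"
    and g: "is_fractal_function N x s lam g" and h: "is_fractal_function N x s lam h"
    and t: "t \<in> {a..b}"
  shows "g t = h t"
proof -
  have ab: "x 0 = a" "x N = b" and mono: "\<forall>l<N. x l < x (Suc l)"
    using part by (auto simp: interval_partition_def)
  have lt: "x 0 < x N" using ab \<open>a < b\<close> by simp
  then have "N \<noteq> 0" by (metis less_irrefl)
  define d where "d r = \<bar>g r - h r\<bar>" for r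
  define S where "S = Max ((\<lambda>l. \<bar>s l\<bar>) ` {..<N})"
  define M where "M = (SUP r\<in>{a..<b}. d r)"
  have ne: "{a..<b} \<noteq> {}" using \<open>a < b\<close> by simp
  have S1: "S < 1" using s \<open>N \<noteq> 0\<close> unfolding S_def by (subst Max_less_iff) auto
  have Sl: "\<bar>s l\<bar> \<le> S" if "l < N" for l using that by (auto simp: S_def)
  have S0: "0 \<le> S" using Sl[of 0] \<open>N \<noteq> 0\<close> by simp
  have "bounded (g ` {a..<b})" "bounded (h ` {a..<b})"
    using g h by (simp_all add: is_fractal_function_def ab)
  then obtain Cg Ch where "\<forall>r\<in>{a..<b}. \<bar>g r\<bar> \<le> Cg" "\<forall>r\<in>{a..<b}. \<bar>h r\<bar> \<le> Ch"
    unfolding bounded_iff by auto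
  then have bdd: "bdd_above (d ` {a..<b})"
    by (intro bdd_aboveI2[of _ _ "Cg + Ch"]) (fastforce simp: d_def)
  have dM: "d r \<le> M" if "r \<in> {a..<b}" for r
    unfolding M_def using that bdd by (rule cSUP_upper)
  have contr: "d r \<le> S * M" if r: "r \<in> {a..<b}" for r
  proof -
    obtain l where l: "l < N" "x l \<le> r" "r < x (Suc l)"
      using partition_piece[OF mono] r ab by auto
    let ?r = "inv (piece_map N x l) r"
    have "g r = s l * g ?r + poly (lam l) ?r" "h r = s l * h ?r + poly (lam l) ?r"
      using g h l by (auto simp: is_fractal_function_def)
    then have "d r = \<bar>s l\<bar> * d ?r"
      by (simp add: d_def abs_mult[symmetric] algebra_simps)
    also have "\<dots> \<le> S * M"
      using Sl[OF l(1)] S0 dM piece_map_inv_mem[OF lt l(2,3)] ab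
      by (intro mult_mono) (auto simp: d_def)
    finally show ?thesis .
  qed
  have "(SUP r\<in>{a..<b}. d r) \<le> S * M" using ne contr by (rule cSUP_least)
  then have "M \<le> S * M" by (simp add: M_def)
  then have "(1 - S) * M \<le> 0" by (simp add: algebra_simps)
  then have "M \<le> 0" using S1 by (simp add: mult_le_0_iff)
  then have eq: "g r = h r" if "r \<in> {a..<b}" for r using dM[OF that] by (simp add: d_def)
  have "eventually (\<lambda>r. r \<in> {a<..<b}) (at_left b)"
    using \<open>a < b\<close> by (rule eventually_at_left_real)
  then have "eventually (\<lambda>r. g r = h r) (at_left b)"
    by eventually_elim (use eq in auto)
  moreover have "(g \<longlongrightarrow> g b) (at_left b)" "(h \<longlongrightarrow> h b) (at_left b)"
    using g h by (auto simp: is_fractal_function_def ab)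
  ultimately have "g b = h b"
    by (metis tendsto_cong tendsto_unique trivial_limit_at_left_real)
  with eq t show ?thesis by (cases "t = b") auto
qed

end

theory Submission
  imports Defs
begin

text \<open>The \<open>\<phi> i\<close> are continuous and linearly independent on \<open>[a, b]\<close>: since \<open>\<phi> i (x j) = \<delta>\<^sub>i\<^sub>j\<close>, a
  combination of them takes its coefficient \<open>j\<close> as its value at \<open>x j\<close>, so if it vanishes, all
  coefficients are \<open>0\<close>. The claim is then that of orthogonal projection onto a finite-dimensional
  space of continuous functions, for the inner product \<open>\<langle>g, h\<rangle> = \<integral> g h\<close>, which is definite on
  continuous functions.

  Gram--Schmidt, as an induction on the set of spanning functions
  (\<open>exists_orthogonal_residual\<close>), gives coefficients \<open>\<alpha>\<close> for which \<open>f - \<Sum>\<alpha>\<^sub>k \<phi>\<^sub>k\<close> is orthogonal to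
  every \<open>\<phi>\<^sub>k\<close>. By Pythagoras (\<open>L2_pythagoras\<close>) any other \<open>\<beta>\<close> has
  \<open>\<parallel>f - \<Sum>\<beta>\<^sub>k \<phi>\<^sub>k\<parallel>\<^sup>2 = \<parallel>f - \<Sum>\<alpha>\<^sub>k \<phi>\<^sub>k\<parallel>\<^sup>2 + \<parallel>\<Sum>(\<alpha>\<^sub>k - \<beta>\<^sub>k) \<phi>\<^sub>k\<parallel>\<^sup>2\<close>. So \<open>\<alpha>\<close> is a minimizer, and another
  minimizer \<open>\<beta>\<close> forces \<open>\<Sum>(\<alpha>\<^sub>k - \<beta>\<^sub>k) \<phi>\<^sub>k = 0\<close>, hence \<open>\<beta> = \<alpha>\<close>.\<close>

definition L2_inner :: "real \<Rightarrow> real \<Rightarrow> (real \<Rightarrow> real) \<Rightarrow> (real \<Rightarrow> real) \<Rightarrow> real" where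
  "L2_inner a b g h = integral {a..b} (\<lambda>t. g t * h t)"

lemma L2_norm_eq_sqrt_inner: "L2_norm a b g = sqrt (L2_inner a b g g)"
  by (simp add: L2_norm_def L2_inner_def power2_eq_square)

lemma L2_inner_commute: "L2_inner a b g h = L2_inner a b h g"
  by (simp add: L2_inner_def mult.commute)

lemma L2_inner_integrable:
  fixes g h :: "real \<Rightarrow> real"
  assumes "continuous_on {a..b} g" "continuous_on {a..b} h"
  shows "(\<lambda>t. g t * h t) integrable_on {a..b}"
  using assms by (intro integrable_continuous_real continuous_intros)

lemma L2_inner_diff_left:
  assumes "continuous_on {a..b} g" "continuous_on {a..b} h" "continuous_on {a..b} k"
  shows "L2_inner a b (\<lambda>t. g t - h t) k = L2_inner a b g k - L2_inner a b h k"
  unfolding L2_inner_def left_diff_distrib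
  using assms by (intro integral_diff L2_inner_integrable)

lemma L2_inner_add_left:
  assumes "continuous_on {a..b} g" "continuous_on {a..b} h" "continuous_on {a..b} k"
  shows "L2_inner a b (\<lambda>t. g t + h t) k = L2_inner a b g k + L2_inner a b h k"
  unfolding L2_inner_def distrib_right
  using assms by (intro integral_add L2_inner_integrable)

lemma L2_inner_scale_left: "L2_inner a b (\<lambda>t. c * g t) h = c * L2_inner a b g h"
  by (simp add: L2_inner_def mult.assoc)

lemma L2_inner_sum_left:
  assumes "finite K" "\<forall>k\<in>K. continuous_on {a..b} (\<phi> k)" "continuous_on {a..b} h"
  shows "L2_inner a b (\<lambda>t. \<Sum>k\<in>K. c k * \<phi> k t) h = (\<Sum>k\<in>K. c k * L2_inner a b (\<phi> k) h)"
proof -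
  have "L2_inner a b (\<lambda>t. \<Sum>k\<in>K. c k * \<phi> k t) h
      = (\<Sum>k\<in>K. L2_inner a b (\<lambda>t. c k * \<phi> k t) h)"
    unfolding L2_inner_def sum_distrib_right
    using assms by (intro integral_sum L2_inner_integrable continuous_intros) auto
  then show ?thesis by (simp add: L2_inner_scale_left)
qed

lemma L2_inner_self_nonneg: "0 \<le> L2_inner a b g g"
  unfolding L2_inner_def by (cases "(\<lambda>t. g t * g t) integrable_on {a..b}")
    (auto intro: integral_nonneg simp: not_integrable_integral)

lemma L2_inner_definite:
  assumes "a < b" "continuous_on {a..b} g" "L2_inner a b g g = 0" "t \<in> {a..b}"
  shows "g t = 0"
proof -
  have "continuous_on {a..b} (\<lambda>t. g t * g t)"
    using assms by (intro continuous_intros)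
  then have "\<forall>t\<in>{a..b}. g t * g t = 0"
    using integral_eq_0_iff[of a b "\<lambda>t. g t * g t"] assms by (simp add: L2_inner_def)
  then show ?thesis using assms(4) by simp
qed

text \<open>One Gram--Schmidt step per added function: its residual \<open>\<psi>\<close> with respect to the previous ones
  is a new direction orthogonal to them, along which the residual of \<open>f\<close> is corrected. If the
  functions are linearly dependent, \<open>\<psi>\<close> may vanish.\<close>

lemma exists_orthogonal_residual:
  assumes "finite K" "a < b" "\<forall>k\<in>K. continuous_on {a..b} (\<phi> k)" "continuous_on {a..b} f"
  shows "\<exists>\<alpha>. \<forall>j\<in>K. L2_inner a b (\<lambda>t. f t - (\<Sum>k\<in>K. \<alpha> k * \<phi> k t)) (\<phi> j) = 0"
  using assms
proof (induction K arbitrary: f rule: finite_induct)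
  case (insert m K)
  have cm: "continuous_on {a..b} (\<phi> m)" and cK: "\<forall>k\<in>K. continuous_on {a..b} (\<phi> k)"
    using insert.prems by auto
  obtain \<beta> where \<beta>: "\<forall>j\<in>K. L2_inner a b (\<lambda>t. f t - (\<Sum>k\<in>K. \<beta> k * \<phi> k t)) (\<phi> j) = 0"
    using insert.IH[OF insert.prems(1) cK insert.prems(3)] by blast
  obtain \<gamma> where \<gamma>: "\<forall>j\<in>K. L2_inner a b (\<lambda>t. \<phi> m t - (\<Sum>k\<in>K. \<gamma> k * \<phi> k t)) (\<phi> j) = 0"
    using insert.IH[OF insert.prems(1) cK cm] by blast
  define r where "r = (\<lambda>t. f t - (\<Sum>k\<in>K. \<beta> k * \<phi> k t))"
  define \<psi> where "\<psi> = (\<lambda>t. \<phi> m t - (\<Sum>k\<in>K. \<gamma> k * \<phi> k t))"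
  have cr: "continuous_on {a..b} r" and c\<psi>: "continuous_on {a..b} \<psi>"
    unfolding r_def \<psi>_def using cK cm insert.prems(3)
    by (intro continuous_intros; simp)+
  \<comment> \<open>If \<open>\<psi>\<close> vanishes, this is \<open>0 / 0 = 0\<close>, which is the right coefficient.\<close>
  define c where "c = L2_inner a b r \<psi> / L2_inner a b \<psi> \<psi>"
  define r' where "r' = (\<lambda>t. r t - c * \<psi> t)"
  have c': "continuous_on {a..b} (\<lambda>t. c * \<psi> t)" using c\<psi> by (intro continuous_intros)
  have cr': "continuous_on {a..b} r'" unfolding r'_def using cr c' by (rule continuous_on_diff)
  have inner_r': "L2_inner a b r' h = L2_inner a b r h - c * L2_inner a b \<psi> h"
    if "continuous_on {a..b} h" for h
    unfolding r'_def using L2_inner_diff_left[OF cr c' that] by (simp only: L2_inner_scale_left)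
  have r'_K: "L2_inner a b r' (\<phi> j) = 0" if "j \<in> K" for j
    using that \<beta> \<gamma> cK inner_r'[of "\<phi> j"] by (simp add: r_def[symmetric] \<psi>_def[symmetric])
  have r'_\<psi>: "L2_inner a b r' \<psi> = 0"
  proof (cases "L2_inner a b \<psi> \<psi> = 0")
    case True
    then have "\<And>t. t \<in> {a..b} \<Longrightarrow> \<psi> t = 0"
      using L2_inner_definite[OF insert.prems(1) c\<psi>] by blast
    then show ?thesis
      unfolding L2_inner_def by (subst integral_cong[where g="\<lambda>_. 0"]) auto
  next
    case False
    then show ?thesis
      using inner_r'[OF c\<psi>] by (simp add: c_def)
  qed
  have sum0: "L2_inner a b (\<lambda>t. \<Sum>k\<in>K. \<gamma> k * \<phi> k t) r' = 0"
    using r'_K by (subst L2_inner_sum_left[OF insert.hyps(1) cK cr'])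
      (simp add: L2_inner_commute[of a b _ r'])
  have cs: "continuous_on {a..b} (\<lambda>t. \<Sum>k\<in>K. \<gamma> k * \<phi> k t)"
    using cK by (intro continuous_intros) auto
  have "L2_inner a b \<psi> r' = L2_inner a b (\<phi> m) r' - 0"
    unfolding \<psi>_def using L2_inner_diff_left[OF cm cs cr'] sum0 by simp
  then have r'_m: "L2_inner a b r' (\<phi> m) = 0"
    using r'_\<psi> by (simp add: L2_inner_commute[of a b r'])
  define \<alpha> where "\<alpha> k = (if k = m then c else \<beta> k - c * \<gamma> k)" for k
  have "(\<Sum>k\<in>K. \<alpha> k * \<phi> k t) = (\<Sum>k\<in>K. \<beta> k * \<phi> k t) - c * (\<Sum>k\<in>K. \<gamma> k * \<phi> k t)" for t
    unfolding sum_distrib_left sum_subtractf[symmetric]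
    using insert.hyps(2) by (intro sum.cong) (auto simp: \<alpha>_def algebra_simps)
  then have "(\<lambda>t. f t - (\<Sum>k\<in>insert m K. \<alpha> k * \<phi> k t)) = r'"
    using insert.hyps by (auto simp: r'_def r_def \<psi>_def \<alpha>_def algebra_simps)
  then show ?case using r'_K r'_m by auto
qed simp

lemma L2_pythagoras:
  assumes "continuous_on {a..b} g" "continuous_on {a..b} h" "L2_inner a b g h = 0"
  shows "L2_inner a b (\<lambda>t. g t + h t) (\<lambda>t. g t + h t) = L2_inner a b g g + L2_inner a b h h"
proof -
  have c: "continuous_on {a..b} (\<lambda>t. g t + h t)" using assms by (intro continuous_intros)
  have "L2_inner a b g (\<lambda>t. g t + h t) = L2_inner a b g g"
    using L2_inner_add_left[OF assms(1,2,1)] assms(3)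
    by (simp add: L2_inner_commute[of a b g "\<lambda>t. g t + h t"] L2_inner_commute[of a b h g])
  moreover have "L2_inner a b h (\<lambda>t. g t + h t) = L2_inner a b h h"
    using L2_inner_add_left[OF assms(1,2,2)] assms(3)
    by (simp add: L2_inner_commute[of a b h "\<lambda>t. g t + h t"])
  ultimately show ?thesis
    using L2_inner_add_left[OF assms(1,2) c] by simp
qed

text \<open>The coefficients are taken extensional on \<open>K\<close>, since values off \<open>K\<close> do not influence the
  approximant and would spoil uniqueness.\<close>

theorem unique_best_L2_approximation:
  fixes \<phi> :: "'i \<Rightarrow> real \<Rightarrow> real"
  assumes "finite K" "a < b" and c\<phi>: "\<forall>k\<in>K. continuous_on {a..b} (\<phi> k)"
    and cf: "continuous_on {a..b} f"
    and indep: "\<And>c. \<forall>t\<in>{a..b}. (\<Sum>k\<in>K. c k * \<phi> k t) = 0 \<Longrightarrow> \<forall>k\<in>K. c k = 0"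
  shows "\<exists>!\<alpha>. is_arg_min (\<lambda>\<beta>. L2_norm a b (\<lambda>t. f t - (\<Sum>k\<in>K. \<beta> k * \<phi> k t)))
                 (\<lambda>\<beta>. \<beta> \<in> K \<rightarrow>\<^sub>E (UNIV :: real set)) \<alpha>"
proof -
  define err where "err \<beta> = L2_norm a b (\<lambda>t. f t - (\<Sum>k\<in>K. \<beta> k * \<phi> k t))" for \<beta>
  obtain \<alpha>' where \<alpha>': "\<forall>j\<in>K. L2_inner a b (\<lambda>t. f t - (\<Sum>k\<in>K. \<alpha>' k * \<phi> k t)) (\<phi> j) = 0"
    using exists_orthogonal_residual[OF assms(1-4)] by blast
  define \<alpha> where "\<alpha> = restrict \<alpha>' K"
  define r where "r = (\<lambda>t. f t - (\<Sum>k\<in>K. \<alpha> k * \<phi> k t))"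
  define w where "w \<beta> = (\<lambda>t. \<Sum>k\<in>K. (\<alpha> k - \<beta> k) * \<phi> k t)" for \<beta>
  have \<alpha>E: "\<alpha> \<in> K \<rightarrow>\<^sub>E UNIV" by (simp add: \<alpha>_def)
  have orth: "L2_inner a b r (\<phi> j) = 0" if "j \<in> K" for j
    using \<alpha>' that by (simp add: r_def \<alpha>_def)
  have cr: "continuous_on {a..b} r" and cw: "continuous_on {a..b} (w \<beta>)" for \<beta>
    unfolding r_def w_def using c\<phi> cf by (intro continuous_intros; simp)+
  have "L2_inner a b r (w \<beta>) = 0" for \<beta>
    unfolding w_def using orth
    by (subst L2_inner_commute, subst L2_inner_sum_left[OF assms(1) c\<phi> cr])
      (simp add: L2_inner_commute[of a b _ r])
  moreover have "(\<lambda>t. f t - (\<Sum>k\<in>K. \<beta> k * \<phi> k t)) = (\<lambda>t. r t + w \<beta> t)" for \<beta>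
    by (simp add: r_def w_def left_diff_distrib sum_subtractf)
  ultimately have err: "err \<beta> = sqrt (L2_inner a b r r + L2_inner a b (w \<beta>) (w \<beta>))" for \<beta>
    using L2_pythagoras[OF cr cw] by (simp add: err_def L2_norm_eq_sqrt_inner)
  have err_\<alpha>: "err \<alpha> = sqrt (L2_inner a b r r)"
    by (simp add: err_def L2_norm_eq_sqrt_inner r_def)
  have best: "err \<alpha> \<le> err \<beta>" for \<beta>
    unfolding err_\<alpha> err[of \<beta>] by (simp add: L2_inner_self_nonneg)
  have "\<exists>!\<alpha>. is_arg_min err (\<lambda>\<beta>. \<beta> \<in> K \<rightarrow>\<^sub>E (UNIV :: real set)) \<alpha>"
  proof (rule ex1I[of _ \<alpha>])
    show "is_arg_min err (\<lambda>\<beta>. \<beta> \<in> K \<rightarrow>\<^sub>E (UNIV :: real set)) \<alpha>"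
      using \<alpha>E best by (simp add: is_arg_min_def not_less)
  next
    fix \<beta> assume "is_arg_min err (\<lambda>\<beta>. \<beta> \<in> K \<rightarrow>\<^sub>E (UNIV :: real set)) \<beta>"
    then have \<beta>E: "\<beta> \<in> K \<rightarrow>\<^sub>E UNIV" and "err \<beta> \<le> err \<alpha>"
      using \<alpha>E by (auto simp: is_arg_min_def not_less)
    then have "L2_inner a b (w \<beta>) (w \<beta>) \<le> 0"
      unfolding err_\<alpha> err[of \<beta>] by simp
    then have "L2_inner a b (w \<beta>) (w \<beta>) = 0"
      using L2_inner_self_nonneg[of a b "w \<beta>"] by simp
    then have "\<forall>t\<in>{a..b}. w \<beta> t = 0"
      using L2_inner_definite[OF assms(2) cw] by blast
    then have "\<forall>k\<in>K. \<alpha> k - \<beta> k = 0"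
      unfolding w_def by (rule indep)
    then show "\<beta> = \<alpha>"
      using \<alpha>E \<beta>E by (intro PiE_ext) auto
  qed
  then show ?thesis unfolding err_def .
qed

lemma interval_partition_node_mem:
  assumes "interval_partition N x a b" "j \<le> N"
  shows "x j \<in> {a..b}"
proof -
  have step: "\<forall>l<N. x l < x (Suc l)" and ends: "x 0 = a" "x N = b"
    using assms by (auto simp: interval_partition_def)
  have "x 0 \<le> x j" using assms(2)
  proof (induction j)
    case (Suc j)
    then show ?case using step[rule_format, of j] by simp
  qed simp
  moreover have "x j \<le> x N" using assms(2)
  proof (induction rule: inc_induct)
    case (step n)
    then show ?case using \<open>\<forall>l<N. x l < x (Suc l)\<close>[rule_format, of n] by simp
  qed simp
  ultimately show ?thesis using ends by simp
qed

theorem theorem3: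
  fixes a b :: real and N :: nat and x s :: "nat \<Rightarrow> real"
    and \<phi> :: "nat \<Rightarrow> real \<Rightarrow> real" and f :: "real \<Rightarrow> real"
  assumes "a < b" and "N \<ge> 2" and "interval_partition N x a b"
    and "\<forall>l<N. \<bar>s l\<bar> < 1"
    and "\<forall>i\<le>N. fractal_interpolation_function N x s (\<lambda>j. if i = j then 1 else 0) (\<phi> i)"
    and "continuous_on {a..b} f"
  shows "\<exists>!\<alpha>. is_arg_min (\<lambda>\<beta>. L2_norm a b (\<lambda>t. f t - (\<Sum>k\<le>N. \<beta> k * \<phi> k t)))
                 (\<lambda>\<beta>. \<beta> \<in> {..N} \<rightarrow>\<^sub>E (UNIV :: real set)) \<alpha>"
proof (rule unique_best_L2_approximation)
  show "\<forall>k\<in>{..N}. continuous_on {a..b} (\<phi> k)"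
    using assms(3,5) by (auto simp: fractal_interpolation_function_def interval_partition_def)
next
  fix c :: "nat \<Rightarrow> real"
  assume zero: "\<forall>t\<in>{a..b}. (\<Sum>k\<le>N. c k * \<phi> k t) = 0"
  show "\<forall>j\<in>{..N}. c j = 0"
  proof
    fix j assume j: "j \<in> {..N}"
    have "(\<Sum>k\<le>N. c k * \<phi> k (x j)) = (\<Sum>k\<le>N. if k = j then c k else 0)"
      using assms(5) j by (intro sum.cong) (auto simp: fractal_interpolation_function_def)
    also have "\<dots> = c j" using j by simp
    finally show "c j = 0"
      using zero interval_partition_node_mem[OF assms(3), of j] j by simp
  qed
qed (use assms in auto)

end
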